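(* Let $X\subseteq\mathbb{R}^{d_X}$ and $U\subseteq\mathbb{R}^{d_U}$ be compact, let $X_T\subseteq X$, let $f\in\mathcal{C}^1(X\times U)^{d_X}$, and let $0\le t\le T$ and $z\in X$. Let $(x_0(s),u_0(s))_{s\in[t,T]}$ be a state and control trajectory such that $$\dot{x}_0(s)=f(x_0(s),u_0(s)),\quad x_0(s)\in X,\quad u_0(s)\in U,\quad s\in[t,T],\qquad x_0(t)=z,\quad x_0(T)\in X_T.$$ Suppose that there exist a real number $\epsilon$ and functions $l\in\mathcal{C}(X\times U)$, $v\in\mathcal{C}^1([0,T]\times X)$ such that $$\mathcal{L}(l,v)(s,x,u)\ge 0\quad\text{for all }(s,x,u)\in[t,T]\times X\times U,$$ $$v(T,x)=0\quad\text{for all }x\in X_T,$$ $$\int_t^T\mathcal{L}(l,v)(s,x_0(s),u_0(s))\,ds\le\epsilon.$$ Then the trajectory $(x_0(s),u_0(s))_{s\in[t,T]}$ is $\epsilon$-optimal for the problem $\mathrm{OCP}(l,z)$ on $[t,T]$.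
   Context: $\mathcal{C}(A)$ and $\mathcal{C}^1(A)$ denote the real-valued continuous, respectively continuously differentiable, functions on $A$; a $\mathcal{C}^1$ function on a compact set is understood as the restriction of a $\mathcal{C}^1$ function defined on an open neighbourhood of that set. The operator $\mathcal{L}$ acts on a pair $(l,v)$ with $l\in\mathcal{C}(X\times U)$ and $v\in\mathcal{C}^1([0,T]\times X)$ by $$\mathcal{L}(l,v)(s,x,u)=l(x,u)+\frac{\partial v}{\partial t}(s,x)+\frac{\partial v}{\partial x}(s,x)^{\top}f(x,u),$$ where $\frac{\partial v}{\partial t}$ denotes the derivative with respect to the first (time) argument. For a Lagrangian $l\in\mathcal{C}(X\times U)$, a fixed final time $T\geq t$ and an initial state $z$ at time $t$, the direct optimal control problem $\mathrm{OCP}(l,z)$ is to minimize the cost $\int_t^T l(x(s),u(s))\,ds$ over all feasible trajectories $(x(s),u(s))_{s\in[t,T]}$, i.e. those satisfying $\dot{x}(s)=f(x(s),u(s))$, $x(s)\in X$, $u(s)\in U$ for $s\in[t,T]$, $x(t)=z$ and $x(T)\in X_T$. Here controls $u$ are measurable, states $x$ are absolutely continuous, and the differential equation holds for almost every $s\in[t,T]$. The infimum need not be attained. A feasible trajectory $(x_0,u_0)$ is $\epsilon$-optimal for $\mathrm{OCP}(l,z)$ if $$\int_t^T l(x_0(s),u_0(s))\,ds\le\epsilon+\inf_{(x,u)}\int_t^T l(x(s),u(s))\,ds,$$ where the infimum is over all feasible trajectories $(x,u)$ of $\mathrm{OCP}(l,z)$. *)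

theory Defs
  imports "HOL-Analysis.Analysis"
begin

text \<open>
  On a compact set \<open>S\<close>, a \<open>C\<^sup>1\<close> function is the restriction to \<open>S\<close> of a \<open>C\<^sup>1\<close> function on an open
  neighbourhood of \<open>S\<close>. The predicate \<open>C1_near S g\<close> says that \<open>g\<close> is itself such an extension, so
  that its derivatives at the points of \<open>S\<close> are meaningful even if \<open>S\<close> has empty interior;
  \<open>C1_on S g\<close> says that \<open>g\<close> agrees on \<open>S\<close> with such an extension.
\<close>

definition C1_near :: "'a::real_normed_vector set \<Rightarrow> ('a \<Rightarrow> 'b::real_normed_vector) \<Rightarrow> bool" where
  "C1_near S g \<longleftrightarrow>
     (\<exists>W. open W \<and> S \<subseteq> W \<and>
        (\<exists>g' :: 'a \<Rightarrow> 'a \<Rightarrow>\<^sub>L 'b.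
           (\<forall>p\<in>W. (g has_derivative blinfun_apply (g' p)) (at p)) \<and> continuous_on W g'))"

definition C1_on :: "'a::real_normed_vector set \<Rightarrow> ('a \<Rightarrow> 'b::real_normed_vector) \<Rightarrow> bool" where
  "C1_on S g \<longleftrightarrow> (\<exists>h. C1_near S h \<and> (\<forall>p\<in>S. g p = h p))"

definition absolutely_continuous_on :: "real set \<Rightarrow> (real \<Rightarrow> 'a::real_normed_vector) \<Rightarrow> bool" where
  "absolutely_continuous_on I g \<longleftrightarrow>
     (\<forall>e>0. \<exists>d>0. \<forall>(n::nat) a b.
        (\<forall>i<n. a i \<le> b i \<and> {a i..b i} \<subseteq> I) \<and>
        disjoint_family_on (\<lambda>i. {a i<..<b i}) {..<n} \<and>
        (\<Sum>i<n. b i - a i) < d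
        \<longrightarrow> (\<Sum>i<n. norm (g (b i) - g (a i))) < e)"

definition gradient :: "(real^'n \<Rightarrow> real) \<Rightarrow> real^'n \<Rightarrow> real^'n" where
  "gradient g x = (\<chi> i. frechet_derivative g (at x) (axis i 1))"

definition L_op ::
  "((real^'n) \<times> (real^'m) \<Rightarrow> real^'n) \<Rightarrow> ((real^'n) \<times> (real^'m) \<Rightarrow> real) \<Rightarrow> (real \<times> (real^'n) \<Rightarrow> real)
     \<Rightarrow> real \<Rightarrow> real^'n \<Rightarrow> real^'m \<Rightarrow> real" where
  "L_op f l v s x u =
     l (x, u) + deriv (\<lambda>\<tau>. v (\<tau>, x)) s + gradient (\<lambda>y. v (s, y)) x \<bullet> f (x, u)"

text \<open>
  Trajectories are total functions on \<open>real\<close>; only their values on \<open>[t, T]\<close> matter.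
\<close>

definition feasible ::
  "((real^'n) \<times> (real^'m) \<Rightarrow> real^'n) \<Rightarrow> (real^'n) set \<Rightarrow> (real^'m) set \<Rightarrow> (real^'n) set
     \<Rightarrow> real \<Rightarrow> real \<Rightarrow> real^'n \<Rightarrow> (real \<Rightarrow> real^'n) \<Rightarrow> (real \<Rightarrow> real^'m) \<Rightarrow> bool" where
  "feasible f X U X\<^sub>T t T z x u \<longleftrightarrow>
     absolutely_continuous_on {t..T} x \<and>
     u \<in> borel_measurable (lebesgue_on {t..T}) \<and>
     (AE s in lebesgue_on {t..T}.
        (x has_vector_derivative f (x s, u s)) (at s within {t..T})) \<and>
     (\<forall>s\<in>{t..T}. x s \<in> X \<and> u s \<in> U) \<and>
     x t = z \<and> x T \<in> X\<^sub>T"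

definition cost ::
  "((real^'n) \<times> (real^'m) \<Rightarrow> real) \<Rightarrow> real \<Rightarrow> real \<Rightarrow> (real \<Rightarrow> real^'n) \<Rightarrow> (real \<Rightarrow> real^'m) \<Rightarrow> real" where
  "cost l t T x u = (\<integral>s. l (x s, u s) \<partial>lebesgue_on {t..T})"

text \<open>
  The infimum is taken in the extended reals, so that it is the genuine infimum without any
  boundedness side condition.
\<close>

definition eps_optimal ::
  "((real^'n) \<times> (real^'m) \<Rightarrow> real^'n) \<Rightarrow> (real^'n) set \<Rightarrow> (real^'m) set \<Rightarrow> (real^'n) set
     \<Rightarrow> real \<Rightarrow> real \<Rightarrow> ((real^'n) \<times> (real^'m) \<Rightarrow> real) \<Rightarrow> real^'n \<Rightarrow> real
     \<Rightarrow> (real \<Rightarrow> real^'n) \<Rightarrow> (real \<Rightarrow> real^'m) \<Rightarrow> bool" where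
  "eps_optimal f X U X\<^sub>T t T l z \<epsilon> x\<^sub>0 u\<^sub>0 \<longleftrightarrow>
     feasible f X U X\<^sub>T t T z x\<^sub>0 u\<^sub>0 \<and>
     ereal (cost l t T x\<^sub>0 u\<^sub>0)
       \<le> ereal \<epsilon> + (INF (x, u)\<in>{(x, u). feasible f X U X\<^sub>T t T z x u}. ereal (cost l t T x u))"

end

theory Submission
  imports Defs
begin

text \<open>
  Along a feasible trajectory \<open>(x, u)\<close> the function \<open>s \<mapsto> v (s, x s)\<close> is absolutely continuous, and
  at almost every \<open>s\<close> the chain rule gives it the derivative
  \<open>L_op f l v s (x s) (u s) - l (x s, u s)\<close>. By the fundamental theorem of calculus and
  \<open>v (T, x T) = 0\<close>,
    \<open>\<integral> L_op f l v s (x s) (u s) ds = cost l t T x u - v (t, z)\<close>.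
  The left-hand side is nonnegative for every feasible trajectory, so \<open>v (t, z)\<close> is a lower bound
  for the value of the problem; for the given trajectory it is at most \<open>\<epsilon>\<close>, so its cost exceeds that
  lower bound by at most \<open>\<epsilon>\<close>.

  The analytic content is the fundamental theorem of calculus for absolutely continuous functions
  (\<open>fundamental_theorem_of_calculus_absolutely_continuous\<close>). It is proved directly for the
  Henstock-Kurzweil integral: the gauge is the usual one where the function is differentiable, and
  keeps the intervals tagged in the exceptional null set inside an open set of small measure, where
  absolute continuity bounds the sum of increments. The passage to the Lebesgue integral rests on
  the sign condition, because a nonnegative Henstock-Kurzweil integrable function is Lebesgue
  integrable.
\<close>

section \<open>Absolutely continuous functions\<close>

text \<open>
  The intervals of a tagged division are not numbered, so the smallness condition is
  restated for arbitrary finite index sets.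
\<close>

lemma absolutely_continuous_on_finite_family:
  fixes g :: "real \<Rightarrow> 'a::real_normed_vector"
  assumes "absolutely_continuous_on I g" and "e > 0"
  shows "\<exists>d>0. \<forall>(A :: 'i set) lo up. finite A \<longrightarrow>
           (\<forall>i\<in>A. lo i \<le> up i \<and> {lo i..up i} \<subseteq> I) \<longrightarrow>
           disjoint_family_on (\<lambda>i. {lo i<..<up i}) A \<longrightarrow>
           (\<Sum>i\<in>A. up i - lo i) < d \<longrightarrow> (\<Sum>i\<in>A. norm (g (up i) - g (lo i))) < e"
proof -
  obtain d where "d > 0" and d: "\<And>(n::nat) a b. (\<forall>i<n. a i \<le> b i \<and> {a i..b i} \<subseteq> I) \<Longrightarrow>
        disjoint_family_on (\<lambda>i. {a i<..<b i}) {..<n} \<Longrightarrow>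
        (\<Sum>i<n. b i - a i) < d \<Longrightarrow> (\<Sum>i<n. norm (g (b i) - g (a i))) < e"
    using assms unfolding absolutely_continuous_on_def by meson
  have "(\<Sum>i\<in>A. norm (g (up i) - g (lo i))) < e"
    if "finite A" and ivl: "\<forall>i\<in>A. lo i \<le> up i \<and> {lo i..up i} \<subseteq> I"
      and disj: "disjoint_family_on (\<lambda>i. {lo i<..<up i}) A"
      and small: "(\<Sum>i\<in>A. up i - lo i) < d" for A :: "'i set" and lo up
  proof -
    obtain h where h: "bij_betw h {..<card A} A"
      using ex_bij_betw_nat_finite[OF \<open>finite A\<close>] by (auto simp: atLeast0LessThan)
    have "(\<Sum>i<card A. norm (g (up (h i)) - g (lo (h i)))) < e"
    proof (rule d)
      show "\<forall>i<card A. lo (h i) \<le> up (h i) \<and> {lo (h i)..up (h i)} \<subseteq> I"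
        using ivl bij_betwE[OF h] by blast
      show "disjoint_family_on (\<lambda>i. {lo (h i)<..<up (h i)}) {..<card A}"
        unfolding disjoint_family_on_def
      proof (intro ballI impI)
        fix m n assume "m \<in> {..<card A}" "n \<in> {..<card A}" "m \<noteq> n"
        then have "h m \<in> A" "h n \<in> A" "h m \<noteq> h n"
          using h by (auto simp: bij_betw_def inj_on_def)
        then show "{lo (h m)<..<up (h m)} \<inter> {lo (h n)<..<up (h n)} = {}"
          using disj unfolding disjoint_family_on_def by blast
      qed
      show "(\<Sum>i<card A. up (h i) - lo (h i)) < d"
        using small sum.reindex_bij_betw[OF h, of "\<lambda>i. up i - lo i"] by simp
    qed
    then show ?thesis
      using sum.reindex_bij_betw[OF h, of "\<lambda>i. norm (g (up i) - g (lo i))"] by simp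
  qed
  with \<open>d > 0\<close> show ?thesis by blast
qed

lemma absolutely_continuous_on_increment:
  fixes g :: "real \<Rightarrow> 'a::real_normed_vector"
  assumes "absolutely_continuous_on I g" and "e > 0"
  shows "\<exists>d>0. \<forall>r s. r \<le> s \<longrightarrow> {r..s} \<subseteq> I \<longrightarrow> s - r < d \<longrightarrow> norm (g s - g r) < e"
proof -
  obtain d where "d > 0" and d: "\<forall>(A :: unit set) lo up. finite A \<longrightarrow>
           (\<forall>i\<in>A. lo i \<le> up i \<and> {lo i..up i} \<subseteq> I) \<longrightarrow>
           disjoint_family_on (\<lambda>i. {lo i<..<up i}) A \<longrightarrow>
           (\<Sum>i\<in>A. up i - lo i) < d \<longrightarrow> (\<Sum>i\<in>A. norm (g (up i) - g (lo i))) < e"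
    using absolutely_continuous_on_finite_family[OF assms] by blast
  have "norm (g s - g r) < e" if "r \<le> s" "{r..s} \<subseteq> I" "s - r < d" for r s
    using d[rule_format, of "{()}" "\<lambda>_. r" "\<lambda>_. s"] that by (simp add: disjoint_family_on_def)
  with \<open>d > 0\<close> show ?thesis by blast
qed

lemma absolutely_continuous_on_imp_continuous_on:
  fixes g :: "real \<Rightarrow> 'a::real_normed_vector"
  assumes "absolutely_continuous_on {a..b} g"
  shows "continuous_on {a..b} g"
  unfolding continuous_on_iff
proof (intro ballI allI impI)
  fix s e :: real assume s: "s \<in> {a..b}" and "e > 0"
  obtain d where "d > 0" and d: "\<forall>r s. r \<le> s \<longrightarrow> {r..s} \<subseteq> {a..b} \<longrightarrow> s - r < d \<longrightarrow> norm (g s - g r) < e"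
    using absolutely_continuous_on_increment[OF assms \<open>e > 0\<close>] by blast
  have "dist (g r) (g s) < e" if "r \<in> {a..b}" "dist r s < d" for r
    using d[rule_format, of r s] d[rule_format, of s r] that s
    by (cases "r \<le> s") (auto simp: dist_norm norm_minus_commute abs_if split: if_splits)
  then show "\<exists>d>0. \<forall>r\<in>{a..b}. dist r s < d \<longrightarrow> dist (g r) (g s) < e"
    using \<open>d > 0\<close> by blast
qed

text \<open>
  A Lipschitz bound for \<open>v\<close> at small scales suffices, since absolute continuity only sees
  increments of \<open>x\<close> over short intervals. On a nonconvex \<open>K\<close> such a bound is what the
  mean value inequality gives.
\<close>

lemma absolutely_continuous_on_compose_graph:
  fixes x :: "real \<Rightarrow> 'a::real_normed_vector" and v :: "real \<times> 'a \<Rightarrow> 'b::real_normed_vector"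
  assumes ac: "absolutely_continuous_on I x"
    and K: "\<And>s. s \<in> I \<Longrightarrow> (s, x s) \<in> K"
    and "C \<ge> 0" and "\<delta> > 0"
    and lip: "\<And>p q. p \<in> K \<Longrightarrow> q \<in> K \<Longrightarrow> dist p q < \<delta> \<Longrightarrow> norm (v q - v p) \<le> C * norm (q - p)"
  shows "absolutely_continuous_on I (\<lambda>s. v (s, x s))"
  unfolding absolutely_continuous_on_def
proof (intro allI impI)
  fix e :: real assume "e > 0"
  \<comment> \<open>\<open>C + 1\<close> instead of \<open>C\<close> keeps the denominator positive; the factor 2 pays for the
      increments of time and of \<open>x\<close> separately.\<close>
  define e' where "e' = e / (2 * (C + 1))"
  have "e' > 0" using \<open>e > 0\<close> \<open>C \<ge> 0\<close> by (simp add: e'_def)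
  have "C * (2 * e') < (C + 1) * (2 * e')" using \<open>e' > 0\<close> by (intro mult_strict_right_mono) auto
  also have "\<dots> = e" using \<open>C \<ge> 0\<close> by (simp add: e'_def field_simps)
  finally have Ce: "C * (2 * e') < e" .
  obtain d1 where "d1 > 0" and d1: "\<And>(n::nat) a b. (\<forall>i<n. a i \<le> b i \<and> {a i..b i} \<subseteq> I) \<and>
        disjoint_family_on (\<lambda>i. {a i<..<b i}) {..<n} \<and> (\<Sum>i<n. b i - a i) < d1 \<Longrightarrow>
        (\<Sum>i<n. norm (x (b i) - x (a i))) < e'"
    using ac \<open>e' > 0\<close> unfolding absolutely_continuous_on_def by meson
  obtain d2 where "d2 > 0"
    and d2: "\<forall>r s. r \<le> s \<longrightarrow> {r..s} \<subseteq> I \<longrightarrow> s - r < d2 \<longrightarrow> norm (x s - x r) < \<delta> / 2"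
    using absolutely_continuous_on_increment[OF ac half_gt_zero[OF \<open>\<delta> > 0\<close>]] by blast
  define d where "d = Min {d1, d2, e', \<delta> / 2}"
  have "d > 0" and d_le: "d \<le> d1" "d \<le> d2" "d \<le> e'" "d \<le> \<delta> / 2"
    using \<open>d1 > 0\<close> \<open>d2 > 0\<close> \<open>e' > 0\<close> \<open>\<delta> > 0\<close> by (auto simp: d_def)
  have "(\<Sum>i<n. norm (v (b i, x (b i)) - v (a i, x (a i)))) < e"
    if ab: "(\<forall>i<n. a i \<le> b i \<and> {a i..b i} \<subseteq> I) \<and>
          disjoint_family_on (\<lambda>i. {a i<..<b i}) {..<n} \<and> (\<Sum>i<n. b i - a i) < d" for n :: nat and a b
  proof -
    have pt: "norm (v (b i, x (b i)) - v (a i, x (a i))) \<le> C * ((b i - a i) + norm (x (b i) - x (a i)))"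
      if "i < n" for i
    proof -
      have le: "a i \<le> b i" and sub: "{a i..b i} \<subseteq> I" using ab that by auto
      have "b i - a i \<le> (\<Sum>i<n. b i - a i)"
        using ab that by (intro member_le_sum) auto
      then have "b i - a i < d" using ab by linarith
      then have "norm (x (b i) - x (a i)) < \<delta> / 2" and "b i - a i < \<delta> / 2"
        using d2[rule_format, OF le sub] d_le by auto
      moreover have pair: "norm ((b i, x (b i)) - (a i, x (a i))) \<le> (b i - a i) + norm (x (b i) - x (a i))"
        using norm_Pair_le[of "b i - a i" "x (b i) - x (a i)"] le by simp
      ultimately have "norm ((b i, x (b i)) - (a i, x (a i))) < \<delta>" by linarith
      then have "dist (a i, x (a i)) (b i, x (b i)) < \<delta>"
        by (subst dist_commute) (simp only: dist_norm)
      moreover have "(a i, x (a i)) \<in> K" "(b i, x (b i)) \<in> K"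
        using le sub by (auto intro!: K)
      ultimately have "norm (v (b i, x (b i)) - v (a i, x (a i))) \<le> C * norm ((b i, x (b i)) - (a i, x (a i)))"
        by (intro lip)
      also have "\<dots> \<le> C * ((b i - a i) + norm (x (b i) - x (a i)))"
        using pair \<open>C \<ge> 0\<close> by (rule mult_left_mono)
      finally show ?thesis .
    qed
    have "(\<Sum>i<n. norm (v (b i, x (b i)) - v (a i, x (a i))))
        \<le> (\<Sum>i<n. C * ((b i - a i) + norm (x (b i) - x (a i))))"
      using pt by (intro sum_mono) auto
    also have "\<dots> = C * ((\<Sum>i<n. b i - a i) + (\<Sum>i<n. norm (x (b i) - x (a i))))"
      by (simp only: sum_distrib_left[symmetric] sum.distrib)
    also have "\<dots> \<le> C * (2 * e')"
    proof (rule mult_left_mono[OF _ \<open>C \<ge> 0\<close>])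
      have "(\<Sum>i<n. norm (x (b i) - x (a i))) < e'"
        using ab d_le by (intro d1) auto
      then show "(\<Sum>i<n. b i - a i) + (\<Sum>i<n. norm (x (b i) - x (a i))) \<le> 2 * e'"
        using ab d_le by linarith
    qed
    finally show ?thesis using Ce by linarith
  qed
  then show "\<exists>d>0. \<forall>(n::nat) a b. (\<forall>i<n. a i \<le> b i \<and> {a i..b i} \<subseteq> I) \<and>
        disjoint_family_on (\<lambda>i. {a i<..<b i}) {..<n} \<and> (\<Sum>i<n. b i - a i) < d \<longrightarrow>
        (\<Sum>i<n. norm (v (b i, x (b i)) - v (a i, x (a i)))) < e"
    using \<open>d > 0\<close> by blast
qed

section \<open>The fundamental theorem of calculus\<close>

text \<open>
  Intervals with disjoint interiors overlap in null sets only, so their lengths add up to the measure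
  of their union.
\<close>

lemma tagged_partial_division_sum_length_le:
  fixes q :: "(real \<times> real set) set"
  assumes q: "q tagged_partial_division_of S"
    and sub: "\<And>s K. (s, K) \<in> q \<Longrightarrow> K \<subseteq> V" and V: "V \<in> lmeasurable"
  shows "(\<Sum>(s, K)\<in>q. Sup K - Inf K) \<le> measure lebesgue V"
proof -
  have cbox: "\<exists>c d. c \<le> d \<and> K = {c..d}" if "(s, K) \<in> q" for s K
    using tagged_partial_division_ofD(2,4)[OF q that] by force
  have "(\<Sum>(s, K)\<in>q. Sup K - Inf K) = (\<Sum>k\<in>q. measure lebesgue (snd k))"
    by (intro sum.cong) (auto dest!: cbox)
  also have "\<dots> = measure lebesgue (\<Union>(snd ` q))"
  proof (rule measure_negligible_finite_Union_image[symmetric])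
    show "finite q" using q by (rule tagged_partial_division_ofD(1))
    show "snd k \<in> lmeasurable" if "k \<in> q" for k
      using that cbox by (cases k) force
    show "pairwise (\<lambda>k k'. negligible (snd k \<inter> snd k')) q"
    proof (rule pairwiseI)
      fix k k' assume k: "k \<in> q" "k' \<in> q" "k \<noteq> k'"
      obtain s K s' K' where eq: "k = (s, K)" "k' = (s', K')" by (metis surj_pair)
      obtain c d where K: "K = {c..d}" using cbox k eq by blast
      obtain c' d' where K': "K' = {c'..d'}" using cbox k eq by blast
      have "interior (K \<inter> K') = {}"
        using tagged_partial_division_ofD(5)[OF q, of s K s' K'] k eq by simp
      then have "negligible (K \<inter> K')"
        unfolding K K' by (intro negligible_convex_interior[THEN iffD2] convex_Int) auto
      then show "negligible (snd k \<inter> snd k')" using eq by simp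
    qed
  qed
  also have "\<dots> \<le> measure lebesgue V"
  proof (rule measure_mono_fmeasurable[OF _ _ V])
    show "\<Union>(snd ` q) \<subseteq> V" using sub by fastforce
    show "\<Union>(snd ` q) \<in> sets lebesgue"
      using tagged_partial_division_ofD(1)[OF q] cbox
      by (intro sets.finite_Union) (auto, metis fmeasurableD lmeasurable_interval(1))
  qed
  finally show ?thesis .
qed

lemma negligible_outer_open:
  fixes N :: "'a::euclidean_space set"
  assumes "negligible N" and "e > 0"
  obtains V where "open V" "N \<subseteq> V" "V \<in> lmeasurable" "measure lebesgue V < e"
proof -
  have N: "N \<in> null_sets lebesgue" using assms by (simp add: negligible_iff_null_sets)
  then obtain V where V: "open V" "N \<subseteq> V" "V - N \<in> lmeasurable" "emeasure lebesgue (V - N) < ennreal e"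
    using sets_lebesgue_outer_open[OF _ \<open>e > 0\<close>] by blast
  have "V \<in> sets lebesgue" using V(1) by auto
  then have em: "emeasure lebesgue V < ennreal e"
    using V(4) emeasure_Diff_null_set[OF N] by simp
  then have "V \<in> lmeasurable"
    using \<open>V \<in> sets lebesgue\<close> by (intro fmeasurableI) (auto intro: less_trans)
  moreover have "measure lebesgue V < e"
    using em \<open>V \<in> lmeasurable\<close> \<open>e > 0\<close> by (simp add: emeasure_eq_measure2 ennreal_less_iff)
  ultimately show thesis using that V by blast
qed

text \<open>
  The set where the derivative fails may be uncountable, which is what separates this from
  the versions of the theorem with countably many exceptions: there continuity controls the
  exceptional tags one at a time, here absolute continuity controls them all together.
\<close>

theorem fundamental_theorem_of_calculus_absolutely_continuous:
  fixes g :: "real \<Rightarrow> 'a::banach"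
  assumes "a \<le> b" and ac: "absolutely_continuous_on {a..b} g" and N: "negligible N"
    and deriv: "\<And>s. s \<in> {a..b} - N \<Longrightarrow> (g has_vector_derivative g' s) (at s within {a..b})"
  shows "(g' has_integral (g b - g a)) {a..b}"
proof (cases "a = b")
  case True
  then show ?thesis using has_integral_refl(1)[of g' a] by simp
next
  case False
  then have "a < b" using \<open>a \<le> b\<close> by simp
  \<comment> \<open>With the value 0 on \<open>N\<close>, the Riemann sum over tags in \<open>N\<close> vanishes.\<close>
  define \<phi> where "\<phi> s = (if s \<in> N then 0 else g' s)" for s
  have "(\<phi> has_integral (g b - g a)) {a..b}"
    unfolding has_integral_factor_content_real
  proof (intro allI impI)
    fix e :: real assume "e > 0"
    have "\<forall>s. \<exists>d>0. s \<in> {a..b} - N \<longrightarrow> (\<forall>y\<in>{a..b}. norm (y - s) < d \<longrightarrow>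
        norm (g y - g s - (y - s) *\<^sub>R \<phi> s) \<le> e / 2 * norm (y - s))"
    proof
      fix s
      show "\<exists>d>0. s \<in> {a..b} - N \<longrightarrow> (\<forall>y\<in>{a..b}. norm (y - s) < d \<longrightarrow>
        norm (g y - g s - (y - s) *\<^sub>R \<phi> s) \<le> e / 2 * norm (y - s))"
      proof (cases "s \<in> {a..b} - N")
        case True
        have "e / 2 > 0" using \<open>e > 0\<close> by simp
        with deriv[OF True] have "\<exists>d>0. \<forall>y\<in>{a..b}. norm (y - s) < d \<longrightarrow>
            norm (g y - g s - (y - s) *\<^sub>R g' s) \<le> e / 2 * norm (y - s)"
          unfolding has_vector_derivative_def has_derivative_within_alt by blast
        with True show ?thesis by (simp add: \<phi>_def)
      qed (auto intro: exI[of _ 1])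
    qed
    then obtain r where r_pos: "\<And>s. r s > 0"
      and r: "\<And>s y. s \<in> {a..b} - N \<Longrightarrow> y \<in> {a..b} \<Longrightarrow> norm (y - s) < r s \<Longrightarrow>
        norm (g y - g s - (y - s) *\<^sub>R \<phi> s) \<le> e / 2 * norm (y - s)"
      by metis
    have "e / 2 * (b - a) > 0" using \<open>e > 0\<close> \<open>a < b\<close> by simp
    then obtain \<eta> where "\<eta> > 0" and \<eta>: "\<forall>(A :: (real \<times> real set) set) lo up. finite A \<longrightarrow>
           (\<forall>i\<in>A. lo i \<le> up i \<and> {lo i..up i} \<subseteq> {a..b}) \<longrightarrow>
           disjoint_family_on (\<lambda>i. {lo i<..<up i}) A \<longrightarrow>
           (\<Sum>i\<in>A. up i - lo i) < \<eta> \<longrightarrow> (\<Sum>i\<in>A. norm (g (up i) - g (lo i))) < e / 2 * (b - a)"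
      using absolutely_continuous_on_finite_family[OF ac] by blast
    obtain V where V: "open V" "N \<subseteq> V" "V \<in> lmeasurable" "measure lebesgue V < \<eta>"
      by (rule negligible_outer_open[OF N \<open>\<eta> > 0\<close>])
    define \<gamma> where "\<gamma> s = (if s \<in> N then V else ball s (r s))" for s
    have "gauge \<gamma>"
      using V r_pos by (auto simp: gauge_def \<gamma>_def)
    moreover have "norm ((\<Sum>(s, K)\<in>p. measure lborel K *\<^sub>R \<phi> s) - (g b - g a)) \<le> e * measure lborel {a..b}"
      if p: "p tagged_division_of {a..b}" and fine: "\<gamma> fine p" for p
    proof -
      note pD = tagged_division_ofD[OF p]
      have cbox: "\<exists>c d. c \<le> d \<and> K = {c..d} \<and> a \<le> c \<and> d \<le> b" if "(s, K) \<in> p" for s K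
        using pD(2-4)[OF that] by force
      define q where "q = {k \<in> p. fst k \<in> N}"
      have "q \<subseteq> p" by (auto simp: q_def)
      have len: "(\<Sum>(s, K)\<in>p. Sup K - Inf K) = b - a"
        and inc: "(\<Sum>(s, K)\<in>p. g (Sup K) - g (Inf K)) = g b - g a"
        using additive_tagged_division_1[OF \<open>a \<le> b\<close> p, of "\<lambda>s. s"]
          additive_tagged_division_1[OF \<open>a \<le> b\<close> p, of g] by auto
      define D where "D = (\<lambda>(s, K). measure lborel K *\<^sub>R \<phi> s - (g (Sup K) - g (Inf K)))"
      have "(\<Sum>(s, K)\<in>p. measure lborel K *\<^sub>R \<phi> s) - (g b - g a) = sum D p"
        unfolding inc[symmetric] D_def by (simp add: sum_subtractf[symmetric] case_prod_unfold)
      also have "\<dots> = sum D (p - q) + sum D q"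
        using pD(1) \<open>q \<subseteq> p\<close> by (simp add: sum.subset_diff)
      finally have split: "(\<Sum>(s, K)\<in>p. measure lborel K *\<^sub>R \<phi> s) - (g b - g a) = sum D (p - q) + sum D q" .

      have "norm (sum D (p - q)) \<le> (\<Sum>k\<in>p - q. e / 2 * (case k of (s, K) \<Rightarrow> Sup K - Inf K))"
      proof (rule sum_norm_le, clarify)
        fix s K assume sK: "(s, K) \<in> p" "(s, K) \<notin> q"
        then have "s \<notin> N" by (simp add: q_def)
        obtain c d where cd: "c \<le> d" "K = {c..d}" "a \<le> c" "d \<le> b" using cbox sK by blast
        have s: "c \<le> s" "s \<le> d" using pD(2)[OF sK(1)] cd by auto
        have "K \<subseteq> ball s (r s)"
          using fineD[OF fine sK(1)] \<open>s \<notin> N\<close> by (simp add: \<gamma>_def)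
        then have "c \<in> ball s (r s)" "d \<in> ball s (r s)" using cd by auto
        then have "norm (c - s) < r s" "norm (d - s) < r s"
          by (auto simp: dist_real_def)
        then have 1: "norm (g c - g s - (c - s) *\<^sub>R \<phi> s) \<le> e / 2 * norm (c - s)"
          and 2: "norm (g d - g s - (d - s) *\<^sub>R \<phi> s) \<le> e / 2 * norm (d - s)"
          using r[of s c] r[of s d] s cd \<open>s \<notin> N\<close> by auto
        have "D (s, K) = (g c - g s - (c - s) *\<^sub>R \<phi> s) - (g d - g s - (d - s) *\<^sub>R \<phi> s)"
          using cd by (simp add: D_def algebra_simps)
        then have "norm (D (s, K)) \<le> e / 2 * norm (c - s) + e / 2 * norm (d - s)"
          using norm_triangle_ineq4[of "g c - g s - (c - s) *\<^sub>R \<phi> s" "g d - g s - (d - s) *\<^sub>R \<phi> s"] 1 2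
          by simp
        also have "\<dots> = e / 2 * (Sup K - Inf K)"
          using s cd by (simp add: distrib_left[symmetric])
        finally show "norm (D (s, K)) \<le> e / 2 * (Sup K - Inf K)" .
      qed
      also have "\<dots> \<le> (\<Sum>k\<in>p. e / 2 * (case k of (s, K) \<Rightarrow> Sup K - Inf K))"
        using pD(1) \<open>e > 0\<close> by (intro sum_mono2) (auto dest!: cbox)
      also have "\<dots> = e / 2 * (b - a)"
        by (simp only: sum_distrib_left[symmetric] len)
      finally have regular: "norm (sum D (p - q)) \<le> e / 2 * (b - a)" .

      have q: "q tagged_partial_division_of {a..b}"
        using p \<open>q \<subseteq> p\<close> tagged_partial_division_subset unfolding tagged_division_of_def by blast
      have qbox: "\<exists>c d. c \<le> d \<and> snd k = {c..d} \<and> a \<le> c \<and> d \<le> b" if "k \<in> q" for k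
        using cbox[of "fst k" "snd k"] that \<open>q \<subseteq> p\<close> by auto
      have "norm (sum D q) \<le> (\<Sum>k\<in>q. norm (g (Sup (snd k)) - g (Inf (snd k))))"
        by (rule sum_norm_le) (auto simp: D_def q_def \<phi>_def norm_minus_commute)
      also have "\<dots> < e / 2 * (b - a)"
      proof (rule \<eta>[rule_format])
        show "finite q" using pD(1) \<open>q \<subseteq> p\<close> by (rule finite_subset[rotated])
        show "Inf (snd k) \<le> Sup (snd k) \<and> {Inf (snd k)..Sup (snd k)} \<subseteq> {a..b}" if "k \<in> q" for k
          using qbox[OF that] by auto
        show "disjoint_family_on (\<lambda>k. {Inf (snd k)<..<Sup (snd k)}) q"
          unfolding disjoint_family_on_def
        proof (intro ballI impI)
          fix k k' assume k: "k \<in> q" "k' \<in> q" "k \<noteq> k'"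
          have int: "interior (snd k) = {Inf (snd k)<..<Sup (snd k)}" if "k \<in> q" for k
            using qbox[OF that] by auto
          show "{Inf (snd k)<..<Sup (snd k)} \<inter> {Inf (snd k')<..<Sup (snd k')} = {}"
            using tagged_partial_division_ofD(5)[OF q, of "fst k" "snd k" "fst k'" "snd k'"] k int
            by (metis prod.collapse)
        qed
        have "(\<Sum>(s, K)\<in>q. Sup K - Inf K) \<le> measure lebesgue V"
        proof (rule tagged_partial_division_sum_length_le[OF q _ V(3)])
          show "K \<subseteq> V" if "(s, K) \<in> q" for s K
            using fineD[OF fine, of s K] that by (auto simp: q_def \<gamma>_def)
        qed
        then show "(\<Sum>k\<in>q. Sup (snd k) - Inf (snd k)) < \<eta>"
          using V(4) by (simp add: case_prod_unfold)
      qed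
      finally have exceptional: "norm (sum D q) \<le> e / 2 * (b - a)" by simp

      show ?thesis
        unfolding split
        using norm_triangle_ineq[of "sum D (p - q)" "sum D q"] regular exceptional \<open>a \<le> b\<close>
        by (simp add: algebra_simps)
    qed
    ultimately show "\<exists>\<gamma>. gauge \<gamma> \<and> (\<forall>p. p tagged_division_of {a..b} \<and> \<gamma> fine p \<longrightarrow>
        norm ((\<Sum>(s, K)\<in>p. measure lborel K *\<^sub>R \<phi> s) - (g b - g a)) \<le> e * measure lborel {a..b})"
      by (intro exI[of _ \<gamma>] conjI allI impI) (simp_all only:)
  qed
  then show ?thesis
    by (rule has_integral_spike[OF N, rotated]) (auto simp: \<phi>_def)
qed

section \<open>Continuously differentiable functions near a compact set\<close>

text \<open>
  The set \<open>K\<close> need not be convex, so the mean value inequality is applied on balls around its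
  points; compactness gives one radius and one derivative bound for all of them.
\<close>

lemma C1_near_compact_locally_lipschitz:
  fixes v :: "'a::euclidean_space \<Rightarrow> 'b::real_normed_vector"
  assumes "C1_near K v" and "compact K"
  shows "\<exists>C\<ge>0. \<exists>\<delta>>0. \<forall>p\<in>K. \<forall>q\<in>K. dist p q < \<delta> \<longrightarrow> norm (v q - v p) \<le> C * norm (q - p)"
proof -
  obtain W g' where W: "open W" "K \<subseteq> W"
    and g': "\<And>p. p \<in> W \<Longrightarrow> (v has_derivative blinfun_apply (g' p)) (at p)"
    and cont: "continuous_on W g'"
    using assms(1) unfolding C1_near_def by blast
  obtain \<rho> where "\<rho> > 0" and \<rho>: "(\<Union>p\<in>K. ball p \<rho>) \<subseteq> W"
    by (rule compact_subset_open_imp_ball_epsilon_subset[OF \<open>compact K\<close> W])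
  define S where "S = {p + y | p y. p \<in> K \<and> y \<in> cball 0 (\<rho> / 2)}"
  have "S \<subseteq> W"
  proof
    fix w assume "w \<in> S"
    then obtain p y where "w = p + y" "p \<in> K" "norm y \<le> \<rho> / 2" by (auto simp: S_def)
    then have "w \<in> ball p \<rho>" using \<open>\<rho> > 0\<close> by (simp add: dist_norm)
    then show "w \<in> W" using \<rho> \<open>p \<in> K\<close> by blast
  qed
  moreover have "compact S"
    unfolding S_def by (intro compact_sums \<open>compact K\<close> compact_cball)
  ultimately have "compact (g' ` S)"
    using cont continuous_on_subset compact_continuous_image by blast
  then obtain C where "C > 0" and C: "\<And>w. w \<in> S \<Longrightarrow> norm (g' w) \<le> C"
    using bounded_pos[of "g' ` S"] compact_imp_bounded by blast
  have "norm (v q - v p) \<le> C * norm (q - p)" if "p \<in> K" "q \<in> K" "dist p q < \<rho> / 2" for p q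
  proof (rule differentiable_bound)
    have sub: "cball p (\<rho> / 2) \<subseteq> S"
    proof
      fix w assume "w \<in> cball p (\<rho> / 2)"
      then have "w = p + (w - p)" "w - p \<in> cball 0 (\<rho> / 2)"
        by (auto simp: dist_norm norm_minus_commute)
      then show "w \<in> S" using \<open>p \<in> K\<close> unfolding S_def by blast
    qed
    show "convex (cball p (\<rho> / 2))" by simp
    show "(v has_derivative blinfun_apply (g' w)) (at w within cball p (\<rho> / 2))"
      if "w \<in> cball p (\<rho> / 2)" for w
      by (rule has_derivative_at_withinI[OF g'[OF subsetD[OF \<open>S \<subseteq> W\<close> subsetD[OF sub that]]]])
    show "onorm (blinfun_apply (g' w)) \<le> C" if "w \<in> cball p (\<rho> / 2)" for w
      using C[of w] sub that by (auto simp: norm_blinfun.rep_eq)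
    show "p \<in> cball p (\<rho> / 2)" "q \<in> cball p (\<rho> / 2)"
      using \<open>\<rho> > 0\<close> that by auto
  qed
  moreover have "C \<ge> 0" "\<rho> / 2 > 0" using \<open>C > 0\<close> \<open>\<rho> > 0\<close> by auto
  ultimately show ?thesis by blast
qed

text \<open>
  The derivative in direction \<open>(1, y)\<close> is the quantity that \<open>L_op\<close> writes with partial derivatives.
\<close>

lemma has_derivative_Pair_partials:
  fixes v :: "real \<times> (real^'n) \<Rightarrow> real"
  assumes v: "(v has_derivative v') (at (s, x))"
  shows "v' (1, y) = deriv (\<lambda>\<tau>. v (\<tau>, x)) s + gradient (\<lambda>w. v (s, w)) x \<bullet> y"
proof -
  interpret v': bounded_linear v' using v by (rule has_derivative_bounded_linear)
  have "((\<lambda>\<tau>. v (\<tau>, x)) has_derivative (\<lambda>h. v' (h, 0))) (at s)"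
    by (rule has_derivative_compose[where f = "\<lambda>\<tau>. (\<tau>, x)" and g = v, simplified])
      (auto intro!: derivative_eq_intros v)
  moreover have "(\<lambda>h. v' (h, 0)) = (\<lambda>h. v' (1, 0) * h)"
  proof
    show "v' (h, 0) = v' (1, 0) * h" for h
      using v'.scaleR[of h "(1, 0)"] by simp
  qed
  ultimately have time: "deriv (\<lambda>\<tau>. v (\<tau>, x)) s = v' (1, 0)"
    by (intro DERIV_imp_deriv) (simp add: has_field_derivative_def)
  have "((\<lambda>w. v (s, w)) has_derivative (\<lambda>h. v' (0, h))) (at x)"
    by (rule has_derivative_compose[where f = "\<lambda>w. (s, w)" and g = v, simplified])
      (auto intro!: derivative_eq_intros v)
  then have frechet: "frechet_derivative (\<lambda>w. v (s, w)) (at x) = (\<lambda>h. v' (0, h))"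
    by (rule frechet_derivative_at[symmetric])
  have lin: "linear (\<lambda>h. v' (0, h))"
    using v'.add[of "(0, _)" "(0, _)"] v'.scaleR[of _ "(0, _)"] by (intro linearI) simp_all
  have "v' (0, y) = (\<lambda>h. v' (0, h)) (\<Sum>i\<in>UNIV. y $ i *\<^sub>R axis i 1)"
    using basis_expansion[of y] by (simp add: scalar_mult_eq_scaleR)
  also have "\<dots> = (\<Sum>i\<in>UNIV. y $ i * v' (0, axis i 1))"
    by (simp add: linear_sum[OF lin] linear_scale[OF lin])
  also have "\<dots> = gradient (\<lambda>w. v (s, w)) x \<bullet> y"
    by (simp add: gradient_def frechet inner_vec_def mult.commute)
  finally have space: "v' (0, y) = gradient (\<lambda>w. v (s, w)) x \<bullet> y" .
  have "v' (1, y) = v' (1, 0) + v' (0, y)"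
    by (simp add: v'.add[symmetric])
  then show ?thesis using time space by simp
qed

section \<open>The dissipation identity along a trajectory\<close>

lemma integrable_running_cost:
  fixes l :: "'a::euclidean_space \<times> 'b::euclidean_space \<Rightarrow> real" and t T :: real
  assumes "compact X" "compact U" and l: "continuous_on (X \<times> U) l"
    and x: "continuous_on {t..T} x" and u: "u \<in> borel_measurable (lebesgue_on {t..T})"
    and XU: "\<And>s. s \<in> {t..T} \<Longrightarrow> x s \<in> X \<and> u s \<in> U"
  shows "integrable (lebesgue_on {t..T}) (\<lambda>s. l (x s, u s))"
proof -
  interpret finite_measure "lebesgue_on {t..T}"
    by (rule finite_measure_lebesgue_on) simp
  have "compact (l ` (X \<times> U))"
    using assms by (intro compact_continuous_image compact_Times)
  then have "bounded (l ` (X \<times> U))" by (rule compact_imp_bounded)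
  then obtain B where B: "\<And>p. p \<in> X \<times> U \<Longrightarrow> norm (l p) \<le> B"
    by (meson bounded_iff imageI)
  have "x \<in> borel_measurable (lebesgue_on {t..T})"
    using x by (rule continuous_imp_measurable_on_sets_lebesgue) simp
  then have "(\<lambda>s. (x s, u s)) \<in> measurable (lebesgue_on {t..T}) (restrict_space borel (X \<times> U))"
    using u XU by (intro measurable_restrict_space2) auto
  from measurable_compose[OF this borel_measurable_continuous_on_restrict[OF l]]
  show ?thesis
    using B XU by (intro integrable_const_bound[where B = B]) auto
qed

text \<open>
  Nonnegativity of \<open>L_op\<close> is what makes its integral a Lebesgue integral: the chain rule and the
  fundamental theorem only give Henstock-Kurzweil integrability.
\<close>

lemma integral_L_op_feasible:
  fixes X :: "(real^'n) set" and U :: "(real^'m) set"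
  assumes "compact X" "compact U" and "0 \<le> t" "t \<le> T"
    and feas: "feasible f X U X\<^sub>T t T z x u"
    and l: "continuous_on (X \<times> U) l" and v: "C1_near ({0..T} \<times> X) v"
    and nonneg: "\<And>s x u. s \<in> {t..T} \<Longrightarrow> x \<in> X \<Longrightarrow> u \<in> U \<Longrightarrow> L_op f l v s x u \<ge> 0"
  shows "(\<integral>s. L_op f l v s (x s) (u s) \<partial>lebesgue_on {t..T}) = cost l t T x u + v (T, x T) - v (t, z)"
proof -
  have ac: "absolutely_continuous_on {t..T} x"
    and u: "u \<in> borel_measurable (lebesgue_on {t..T})"
    and ode: "AE s in lebesgue_on {t..T}. (x has_vector_derivative f (x s, u s)) (at s within {t..T})"
    and XU: "\<And>s. s \<in> {t..T} \<Longrightarrow> x s \<in> X \<and> u s \<in> U" and "x t = z"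
    using feas unfolding feasible_def by auto
  have "AE s in lebesgue. s \<in> {t..T} \<longrightarrow> (x has_vector_derivative f (x s, u s)) (at s within {t..T})"
    using ode by (subst (asm) AE_restrict_space_iff) auto
  then obtain N where N: "negligible N"
    and xd: "\<And>s. s \<in> {t..T} - N \<Longrightarrow> (x has_vector_derivative f (x s, u s)) (at s within {t..T})"
    unfolding eventually_ae_filter_negligible by blast
  have graph: "(s, x s) \<in> {0..T} \<times> X" if "s \<in> {t..T}" for s
    using XU that \<open>0 \<le> t\<close> by auto
  obtain v' where v': "\<And>p. p \<in> {0..T} \<times> X \<Longrightarrow> (v has_derivative v' p) (at p)"
    using v unfolding C1_near_def by (meson subsetD)

  have "compact ({0..T} \<times> X)" using \<open>compact X\<close> by (intro compact_Times) auto
  then obtain C \<delta> where "C \<ge> 0" "\<delta> > 0"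
    and lip: "\<forall>p\<in>{0..T} \<times> X. \<forall>q\<in>{0..T} \<times> X. dist p q < \<delta> \<longrightarrow> norm (v q - v p) \<le> C * norm (q - p)"
    using C1_near_compact_locally_lipschitz[OF v] by blast
  then have acv: "absolutely_continuous_on {t..T} (\<lambda>s. v (s, x s))"
    using graph by (intro absolutely_continuous_on_compose_graph[OF ac _ _ _ lip[rule_format]])

  have "((\<lambda>s. L_op f l v s (x s) (u s) - l (x s, u s)) has_integral (v (T, x T) - v (t, x t))) {t..T}"
  proof (rule fundamental_theorem_of_calculus_absolutely_continuous[OF \<open>t \<le> T\<close> acv N])
    fix s assume s: "s \<in> {t..T} - N"
    then have vd: "(v has_derivative v' (s, x s)) (at (s, x s))" using v' graph by blast
    have "((\<lambda>r. (r, x r)) has_vector_derivative (1, f (x s, u s))) (at s within {t..T})"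
      by (intro has_vector_derivative_Pair has_vector_derivative_id xd s)
    then have "((\<lambda>r. v (r, x r)) has_vector_derivative v' (s, x s) (1, f (x s, u s))) (at s within {t..T})"
      using vector_derivative_diff_chain_within[of "\<lambda>r. (r, x r)" _ s "{t..T}" v "v' (s, x s)"]
        has_derivative_at_withinI[OF vd] by (simp add: o_def)
    also have "v' (s, x s) (1, f (x s, u s)) = L_op f l v s (x s) (u s) - l (x s, u s)"
      unfolding has_derivative_Pair_partials[OF vd] L_op_def by simp
    finally show "((\<lambda>s. v (s, x s)) has_vector_derivative L_op f l v s (x s) (u s) - l (x s, u s))
        (at s within {t..T})" .
  qed
  moreover have "((\<lambda>s. l (x s, u s)) has_integral cost l t T x u) {t..T}"
    unfolding cost_def
    using integrable_running_cost[OF assms(1,2) l absolutely_continuous_on_imp_continuous_on[OF ac] u XU]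
    by (intro has_integral_integral_lebesgue_on) auto
  ultimately have int: "((\<lambda>s. L_op f l v s (x s) (u s)) has_integral
      (cost l t T x u + v (T, x T) - v (t, z))) {t..T}"
    using has_integral_add[of "\<lambda>s. L_op f l v s (x s) (u s) - l (x s, u s)" "v (T, x T) - v (t, x t)"
        "{t..T}" "\<lambda>s. l (x s, u s)" "cost l t T x u"] \<open>x t = z\<close> by (simp add: algebra_simps)
  then have "(\<lambda>s. L_op f l v s (x s) (u s)) absolutely_integrable_on {t..T}"
    using nonneg XU by (intro nonnegative_absolutely_integrable_1) (auto intro: has_integral_integrable)
  then have "integrable (lebesgue_on {t..T}) (\<lambda>s. L_op f l v s (x s) (u s))"
    by (simp add: integrable_restrict_space set_integrable_def)
  then show ?thesis
    using int by (simp add: lebesgue_integral_eq_integral integral_unique)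
qed

section \<open>Epsilon-optimality\<close>

theorem proposition3p2:
  fixes X :: "(real^'n) set" and U :: "(real^'m) set" and X\<^sub>T :: "(real^'n) set"
    and f :: "(real^'n) \<times> (real^'m) \<Rightarrow> real^'n"
    and t T \<epsilon> :: real and z :: "real^'n"
    and x\<^sub>0 :: "real \<Rightarrow> real^'n" and u\<^sub>0 :: "real \<Rightarrow> real^'m"
    and l :: "(real^'n) \<times> (real^'m) \<Rightarrow> real"
    and v :: "real \<times> (real^'n) \<Rightarrow> real"
  assumes "compact X" and "compact U" and "X\<^sub>T \<subseteq> X"
    and "C1_on (X \<times> U) f"
    and "0 \<le> t" and "t \<le> T" and "z \<in> X"
    and "feasible f X U X\<^sub>T t T z x\<^sub>0 u\<^sub>0"
    and "continuous_on (X \<times> U) l"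
    and "C1_near ({0..T} \<times> X) v"
    and "\<And>s x u. s \<in> {t..T} \<Longrightarrow> x \<in> X \<Longrightarrow> u \<in> U \<Longrightarrow> L_op f l v s x u \<ge> 0"
    and "\<And>x. x \<in> X\<^sub>T \<Longrightarrow> v (T, x) = 0"
    and "(\<integral>s. L_op f l v s (x\<^sub>0 s) (u\<^sub>0 s) \<partial>lebesgue_on {t..T}) \<le> \<epsilon>"
  shows "eps_optimal f X U X\<^sub>T t T l z \<epsilon> x\<^sub>0 u\<^sub>0"
proof -
  have identity: "(\<integral>s. L_op f l v s (x s) (u s) \<partial>lebesgue_on {t..T}) = cost l t T x u - v (t, z)"
    if "feasible f X U X\<^sub>T t T z x u" for x u
  proof -
    have "v (T, x T) = 0" using that assms(12) by (simp add: feasible_def)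
    then show ?thesis
      using integral_L_op_feasible[OF assms(1,2,5,6) that assms(9,10,11)] by simp
  qed
  have bound: "v (t, z) \<le> cost l t T x u" if feas: "feasible f X U X\<^sub>T t T z x u" for x u
  proof -
    have "(\<integral>s. L_op f l v s (x s) (u s) \<partial>lebesgue_on {t..T}) \<ge> 0"
      using feas assms(11) by (intro integral_nonneg_AE AE_I2) (auto simp: feasible_def)
    then show ?thesis using identity[OF feas] by simp
  qed
  have "cost l t T x\<^sub>0 u\<^sub>0 \<le> \<epsilon> + v (t, z)"
    using identity[OF assms(8)] assms(13) by simp
  then have "ereal (cost l t T x\<^sub>0 u\<^sub>0) \<le> ereal \<epsilon> + ereal (v (t, z))"
    by simp
  also have "\<dots> \<le> ereal \<epsilon> + (INF (x, u)\<in>{(x, u). feasible f X U X\<^sub>T t T z x u}. ereal (cost l t T x u))"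
    by (intro add_left_mono INF_greatest) (auto intro: bound)
  finally show ?thesis
    using assms(8) by (simp add: eps_optimal_def)
qed

end
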